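(* Let $G$ be a finite abelian group of size $n$ and let $D=\mathbb{Z}_2\ltimes G$ be the corresponding generalized dihedral group, of size $2n$. Let $\mathcal S_{D,m}$ denote the collection of subsets of $D$ of size $m$, and let $j$ denote the number of elements of $G$ with order at most $2$. If $6\le m\le c_j\sqrt n$, where $c_j=1.3229/\sqrt{111+5j}$, then there are (strictly) more MSTD sets than MDTS sets in $\mathcal S_{D,m}$.
   Context: The generalized dihedral group of an abelian group $G$ is $D=\mathbb{Z}_2\ltimes G$, where the nonidentity element of $\mathbb{Z}_2$ acts on $G$ by inversion. For a subset $A$ of a (multiplicatively written) group, $A+A=\{a_1a_2:a_1,a_2\in A\}$ and $A-A=\{a_1a_2^{-1}:a_1,a_2\in A\}$. $A$ is MSTD (more sums than differences) if $|A+A|>|A-A|$, and MDTS (more differences than sums) if $|A+A|<|A-A|$. The identity element counts among the elements of order at most $2$. *)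

theory Defs
  imports "HOL-Algebra.Algebra" Complex_Main
begin

text \<open>\<open>semidirect H N \<phi>\<close> is \<open>H \<ltimes> N\<close>, where \<open>h\<close> acts on \<open>N\<close> by the
  automorphism \<open>\<phi> h\<close>. The pair \<open>(h, x)\<close> stands for the product \<open>x h\<close>, so the relation
  \<open>h x h\<inverse> = \<phi> h x\<close> gives \<open>(x h) (y k) = (x \<cdot> \<phi> h y) (h k)\<close>.\<close>

definition semidirect ::
  "('h, 'c) monoid_scheme \<Rightarrow> ('n, 'd) monoid_scheme \<Rightarrow> ('h \<Rightarrow> 'n \<Rightarrow> 'n) \<Rightarrow> ('h \<times> 'n) monoid"
  where "semidirect H N \<phi> =
    \<lparr>carrier = carrier H \<times> carrier N,
     monoid.mult = (\<lambda>(h, x) (k, y). (h \<otimes>\<^bsub>H\<^esub> k, x \<otimes>\<^bsub>N\<^esub> \<phi> h y)),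
     one = (\<one>\<^bsub>H\<^esub>, \<one>\<^bsub>N\<^esub>)\<rparr>"

definition gen_dihedral :: "('a, 'b) monoid_scheme \<Rightarrow> (int \<times> 'a) monoid"
  where "gen_dihedral G =
    semidirect (integer_mod_group 2) G (\<lambda>e x. if e = 0 then x else inv\<^bsub>G\<^esub> x)"

text \<open>The sumset \<open>A + A\<close> is the library's \<open>A <#>\<^bsub>G\<^esub> A\<close>.\<close>

definition diffset :: "('a, 'b) monoid_scheme \<Rightarrow> 'a set \<Rightarrow> 'a set"
  where "diffset G A = {a \<otimes>\<^bsub>G\<^esub> inv\<^bsub>G\<^esub> b | a b. a \<in> A \<and> b \<in> A}"

definition MSTD :: "('a, 'b) monoid_scheme \<Rightarrow> 'a set \<Rightarrow> bool"
  where "MSTD G A \<longleftrightarrow> card (A <#>\<^bsub>G\<^esub> A) > card (diffset G A)"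

definition MDTS :: "('a, 'b) monoid_scheme \<Rightarrow> 'a set \<Rightarrow> bool"
  where "MDTS G A \<longleftrightarrow> card (A <#>\<^bsub>G\<^esub> A) < card (diffset G A)"

definition subsets_of_size :: "('a, 'b) monoid_scheme \<Rightarrow> nat \<Rightarrow> 'a set set"
  where "subsets_of_size G m = {A. A \<subseteq> carrier G \<and> card A = m}"

text \<open>In an infinite group \<open>group.ord\<close> is \<open>0\<close> on elements of infinite order, so this counts
  elements of order at most \<open>2\<close> only for finite \<open>G\<close>.\<close>

definition num_ord_le_2 :: "('a, 'b) monoid_scheme \<Rightarrow> nat"
  where "num_ord_le_2 G = card {x \<in> carrier G. group.ord G x \<le> 2}"

lemma group_gen_dihedral:
  assumes "comm_group G"
  shows "group (gen_dihedral G)"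
proof -
  interpret comm_group G by fact
  show ?thesis
  proof (rule groupI)
    fix x y z
    assume x: "x \<in> carrier (gen_dihedral G)" and y: "y \<in> carrier (gen_dihedral G)"
      and z: "z \<in> carrier (gen_dihedral G)"
    obtain a g b h c k where eq: "x = (a, g)" "y = (b, h)" "z = (c, k)"
      by (metis surj_pair)
    have "a = 0 \<or> a = 1" "b = 0 \<or> b = 1" "c = 0 \<or> c = 1"
      "g \<in> carrier G" "h \<in> carrier G" "k \<in> carrier G"
      using x y z unfolding eq
      by (auto simp: gen_dihedral_def semidirect_def carrier_integer_mod_group)
    then show "x \<otimes>\<^bsub>gen_dihedral G\<^esub> y \<otimes>\<^bsub>gen_dihedral G\<^esub> z =
        x \<otimes>\<^bsub>gen_dihedral G\<^esub> (y \<otimes>\<^bsub>gen_dihedral G\<^esub> z)"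
      unfolding eq
      by (elim disjE) (simp_all add: gen_dihedral_def semidirect_def inv_mult m_assoc)
  next
    fix x assume "x \<in> carrier (gen_dihedral G)"
    moreover obtain a g where x: "x = (a, g)"
      by (metis surj_pair)
    ultimately have "a = 0 \<or> a = 1" "g \<in> carrier G"
      by (auto simp: gen_dihedral_def semidirect_def carrier_integer_mod_group)
    then show "\<exists>y\<in>carrier (gen_dihedral G). y \<otimes>\<^bsub>gen_dihedral G\<^esub> x = \<one>\<^bsub>gen_dihedral G\<^esub>"
      unfolding x
      by (intro bexI[of _ "(a, if a = 0 then inv\<^bsub>G\<^esub> g else g)"])
        (auto simp: gen_dihedral_def semidirect_def carrier_integer_mod_group)
  qed (auto simp: gen_dihedral_def semidirect_def carrier_integer_mod_group)
qed

lemma order_gen_dihedral: "order (gen_dihedral G) = 2 * order G"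
  by (simp add: order_def gen_dihedral_def semidirect_def carrier_integer_mod_group
      card_cartesian_product)

end

theory Submission
  imports Defs
begin

text \<open>
  Write the elements of the dihedral group as rotations \<open>(0, x)\<close> and reflections \<open>(1, x)\<close>, so
  that a set \<open>A\<close> of size \<open>m\<close> is a set \<open>R\<close> of \<open>k\<close> rotations together with a set \<open>F\<close> of
  \<open>l = m - k\<close> reflections. The products of \<open>A\<close> are the rotations \<open>R R \<union> F F\<inverse>\<close> and the reflections
  \<open>F R \<union> F R\<inverse>\<close>. A reflection is its own inverse, so the quotients of \<open>A\<close> are the rotations
  \<open>R R\<inverse> \<union> F F\<inverse>\<close> and only the reflections \<open>F R\<close>. If no products coincide by accident, then passing
  from quotients to products gains \<open>k l\<close> reflections and loses about \<open>k\<^sup>2 / 2\<close> rotations, because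
  \<open>G\<close> is abelian. Hence sums win as long as \<open>k\<close> is between \<open>1\<close> and about \<open>2 m / 3\<close>. The number
  \<open>w k\<close> of sets with \<open>k\<close> rotations is symmetric under \<open>k \<mapsto> m - k\<close>, so this favours the MSTD sets.

  Accidental coincidences are controlled by a first moment argument. Their number in \<open>A\<close> is bounded
  by a count of quadruples satisfying one equation
  (\<open>differences_le_sums_plus_coincidences\<close>), and a fixed set of \<open>t\<close> elements lies in a
  random \<open>k\<close>-subset with probability at most \<open>(k / n)\<^sup>t\<close> (\<open>sum_coincidences_le\<close>). The mean is of order
  \<open>k m\<^sup>3 / n\<close>, while the surplus of products over quotients to be destroyed is of order \<open>k m\<close>. As
  \<open>m\<^sup>2 (111 + 5 j) \<le> 2 n\<close>, Markov's inequality shows that the sets with \<open>k\<close> rotations that fail to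
  be MSTD form at most a fraction \<open>1 / 20\<close> of all if \<open>1 \<le> k < M\<close>, and at most \<open>1 / 8\<close> if
  \<open>M \<le> k \<le> m - M\<close>, where \<open>M\<close> is about \<open>4 m / 9\<close> (\<open>card_not_MSTD_le\<close>).

  For \<open>k > m - M\<close> every set may be conceded to MDTS, and for \<open>k = 0\<close> no set is MDTS. Pairing \<open>k\<close> with
  \<open>m - k\<close>, the range \<open>k < M\<close> almost compensates the range \<open>k > m - M\<close>, and what is missing is
  outweighed by the central range \<open>M \<le> k \<le> m - M\<close>, because \<open>w\<close> is unimodal
  (\<open>weighted_sum_pos\<close>).
\<close>

section \<open>Counting\<close>

text \<open>If \<open>\<phi>\<close> is expected to be constant on the classes \<open>E q\<close>, of size at most \<open>d\<close>, then its image has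
  at least \<open>card P / d\<close> elements, up to unexpected coincidences: choose one representative for each
  value; every element outside the classes of the representatives collides with one of them.\<close>

lemma card_le_collisions:
  assumes fin: "finite P" and E: "\<And>q. q \<in> P \<Longrightarrow> finite (E q) \<and> card (E q) \<le> d"
  shows "card P \<le> d * card (\<phi> ` P) + card {(p, q) \<in> P \<times> P. p \<notin> E q \<and> \<phi> p = \<phi> q}"
proof -
  let ?C = "{(p, q) \<in> P \<times> P. p \<notin> E q \<and> \<phi> p = \<phi> q}"
  define rep where "rep p = inv_into P \<phi> (\<phi> p)" for p
  have rep: "rep p \<in> P" "\<phi> (rep p) = \<phi> p" if "p \<in> P" for p
    using that by (auto simp: rep_def inv_into_into f_inv_into_f)
  have img: "rep ` P = inv_into P \<phi> ` \<phi> ` P"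
    by (auto simp: rep_def)
  have "card (\<Union>q\<in>rep ` P. E q) \<le> (\<Sum>q\<in>rep ` P. card (E q))"
    using fin by (intro card_UN_le) auto
  also have "\<dots> \<le> (\<Sum>q\<in>rep ` P. d)"
    using rep E by (intro sum_mono) auto
  also have "\<dots> = d * card (rep ` P)"
    by simp
  also have "\<dots> \<le> d * card (\<phi> ` P)"
    unfolding img using fin by (intro mult_le_mono2 card_image_le) auto
  finally have 1: "card (\<Union>q\<in>rep ` P. E q) \<le> d * card (\<phi> ` P)" .
  have finC: "finite ?C"
    by (rule finite_subset[of _ "P \<times> P"]) (use fin in auto)
  have 2: "card {p \<in> P. p \<notin> E (rep p)} \<le> card ?C"
    by (rule card_inj_on_le[of "\<lambda>p. (p, rep p)"]) (use finC rep in \<open>auto simp: inj_on_def\<close>)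
  have finE: "finite (E q)" if "q \<in> P" for q
    using E that by blast
  have "card P \<le> card ((\<Union>q\<in>rep ` P. E q) \<union> {p \<in> P. p \<notin> E (rep p)})"
    using fin finE rep by (intro card_mono) auto
  also have "\<dots> \<le> card (\<Union>q\<in>rep ` P. E q) + card {p \<in> P. p \<notin> E (rep p)}"
    by (rule card_Un_le)
  finally show ?thesis
    using 1 2 by linarith
qed

lemma card_image_Int_le:
  assumes "finite P" "finite Q"
  shows "card (\<phi> ` P \<inter> \<psi> ` Q) \<le> card {(p, q) \<in> P \<times> Q. \<phi> p = \<psi> q}"
proof (rule surj_card_le[of _ _ "\<lambda>(p, q). \<phi> p"])
  show "finite {(p, q) \<in> P \<times> Q. \<phi> p = \<psi> q}"
    by (rule finite_subset[of _ "P \<times> Q"]) (use assms in auto)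
qed force

lemma card_off_diagonal:
  assumes "finite R"
  shows "card {(a, b) \<in> R \<times> R. a \<noteq> b} + card R = card R * card R"
proof -
  have "R \<times> R = {(a, b) \<in> R \<times> R. a \<noteq> b} \<union> (\<lambda>a. (a, a)) ` R"
    by auto
  then have "card (R \<times> R) = card ({(a, b) \<in> R \<times> R. a \<noteq> b} \<union> (\<lambda>a. (a, a)) ` R)"
    by (rule arg_cong)
  moreover have "card ({(a, b) \<in> R \<times> R. a \<noteq> b} \<union> (\<lambda>a. (a, a)) ` R)
      = card {(a, b) \<in> R \<times> R. a \<noteq> b} + card ((\<lambda>a. (a, a)) ` R)"
    by (rule card_Un_disjoint)
      (use assms in \<open>auto intro: finite_subset[of _ "R \<times> R"]\<close>)
  moreover have "card ((\<lambda>a. (a, a)) ` R) = card R"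
    by (simp add: card_image inj_on_def)
  ultimately show ?thesis
    by (simp only: card_cartesian_product)
qed

text \<open>The falling factorials satisfy \<open>k (k - 1) \<dots> (k - t + 1) / (n (n - 1) \<dots> (n - t + 1)) \<le> (k / n)\<^sup>t\<close>
  factor by factor.\<close>

lemma choose_diff_mult_power_le:
  assumes "t \<le> k" "t \<le> n"
  shows "((n - t) choose (k - t)) * n ^ t \<le> (n choose k) * k ^ t"
  using assms
proof (induction t)
  case (Suc t)
  obtain a b where ab: "n - t = Suc a" "k - t = Suc b"
    using Suc.prems by (metis Suc_diff_Suc Suc_le_lessD)
  have ab': "n - Suc t = a" "k - Suc t = b"
    using ab by auto
  have step: "n * (a choose b) \<le> k * (Suc a choose Suc b)"
  proof (cases "k \<le> n")
    case True
    have "n = t + Suc a" "k = t + Suc b"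
      using ab by auto
    then have le: "n * Suc b \<le> k * Suc a"
      using True by (simp add: algebra_simps)
    have "Suc a * (n * (a choose b)) = n * Suc b * (Suc a choose Suc b)"
      using Suc_times_binomial_eq[of a b] by (simp add: algebra_simps)
    also have "\<dots> \<le> Suc a * (k * (Suc a choose Suc b))"
      using mult_le_mono1[OF le, of "Suc a choose Suc b"] by (simp only: ac_simps)
    finally show ?thesis
      by (simp only: Suc_mult_le_cancel1)
  next
    case False
    then have "a < b"
      using ab by auto
    then show ?thesis
      by (simp add: binomial_eq_0)
  qed
  have "((n - Suc t) choose (k - Suc t)) * n ^ Suc t = (n * (a choose b)) * n ^ t"
    by (simp add: ab')
  also have "\<dots> \<le> (k * (Suc a choose Suc b)) * n ^ t"
    by (rule mult_le_mono1[OF step])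
  also have "\<dots> = k * (((n - t) choose (k - t)) * n ^ t)"
    by (simp add: ab)
  also have "\<dots> \<le> k * ((n choose k) * k ^ t)"
    using Suc by (intro mult_le_mono2) auto
  finally show ?case
    by (simp add: ac_simps)
qed simp

text \<open>In probabilistic terms: a random \<open>k\<close>-subset of \<open>V\<close> contains \<open>T\<close> with probability at most
  \<open>(k / card V) ^ card T\<close>.\<close>

lemma card_supersets:
  assumes fin: "finite V" and T: "T \<subseteq> V"
  shows "card {R. T \<subseteq> R \<and> R \<subseteq> V \<and> card R = k} * card V ^ card T
      \<le> (card V choose k) * k ^ card T"
proof (cases "card T \<le> k")
  case True
  have finT: "finite T"
    using fin T finite_subset by blast
  have "bij_betw (\<lambda>B. B \<union> T) {B. B \<subseteq> V - T \<and> card B = k - card T}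
      {R. T \<subseteq> R \<and> R \<subseteq> V \<and> card R = k}"
  proof (rule bij_betw_byWitness[where f' = "\<lambda>R. R - T"])
    show "(\<lambda>B. B \<union> T) ` {B. B \<subseteq> V - T \<and> card B = k - card T}
        \<subseteq> {R. T \<subseteq> R \<and> R \<subseteq> V \<and> card R = k}"
    proof clarify
      fix B assume B: "B \<subseteq> V - T" "card B = k - card T"
      then have "card (B \<union> T) = card B + card T"
        using fin finT by (intro card_Un_disjoint) (auto intro: finite_subset)
      then show "T \<subseteq> B \<union> T \<and> B \<union> T \<subseteq> V \<and> card (B \<union> T) = k"
        using B T True by auto
    qed
  qed (auto simp: card_Diff_subset finT)
  then have "card {R. T \<subseteq> R \<and> R \<subseteq> V \<and> card R = k}
      = card {B. B \<subseteq> V - T \<and> card B = k - card T}"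
    using bij_betw_same_card by force
  also have "\<dots> = (card V - card T) choose (k - card T)"
    using fin finT T by (simp add: n_subsets card_Diff_subset)
  finally show ?thesis
    using choose_diff_mult_power_le[OF True card_mono[OF fin T]] by simp
next
  case False
  then have "{R. T \<subseteq> R \<and> R \<subseteq> V \<and> card R = k} = {}"
    using fin card_mono[OF finite_subset[OF _ fin]] by auto
  then show ?thesis
    by (simp only: card.empty)
qed

definition size_pairs :: "'a set \<Rightarrow> nat \<Rightarrow> nat \<Rightarrow> ('a set \<times> 'a set) set"
  where "size_pairs V k l = {R. R \<subseteq> V \<and> card R = k} \<times> {F. F \<subseteq> V \<and> card F = l}"

lemma finite_size_pairs: "finite V \<Longrightarrow> finite (size_pairs V k l)"
  by (auto simp: size_pairs_def)

lemma card_size_pairs: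
  "finite V \<Longrightarrow> card (size_pairs V k l) = (card V choose k) * (card V choose l)"
  by (simp add: size_pairs_def card_cartesian_product n_subsets)

text \<open>Linearity of expectation: each pattern \<open>q\<close> is contained in a random pair \<open>(R, F)\<close> with
  probability at most \<open>(k / n)\<^sup>s (l / n)\<^sup>t\<close>. The patterns will be the solutions of one equation in \<open>s + t\<close>
  distinct unknowns, of which there are at most \<open>c\<close> times the power \<open>s + t - 1\<close> of \<open>n\<close>; the mean number of
  contained patterns is then at most \<open>c k\<^sup>s l\<^sup>t / n\<close>. The bound on \<open>card Q\<close> is multiplied by
  \<open>n\<close> so that the exponent does not involve a subtraction.\<close>

lemma sum_card_patterns_le:
  fixes S T :: "'q \<Rightarrow> 'a set"
  assumes fin: "finite V" "finite Q" and ne: "V \<noteq> {}"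
    and Q: "\<And>q. q \<in> Q \<Longrightarrow> S q \<subseteq> V \<and> T q \<subseteq> V \<and> card (S q) = s \<and> card (T q) = t"
    and few: "card Q * card V \<le> c * card V ^ (s + t)"
  shows "card V * (\<Sum>(R, F)\<in>size_pairs V k l. card {q \<in> Q. S q \<subseteq> R \<and> T q \<subseteq> F})
      \<le> c * k ^ s * l ^ t * card (size_pairs V k l)"
proof -
  let ?n = "card V" and ?P = "size_pairs V k l"
  let ?N = "\<Sum>(R, F)\<in>?P. card {q \<in> Q. S q \<subseteq> R \<and> T q \<subseteq> F}"
  have one: "card {x \<in> ?P. S q \<subseteq> fst x \<and> T q \<subseteq> snd x} * ?n ^ (s + t)
      \<le> k ^ s * l ^ t * card ?P" if "q \<in> Q" for q
  proof -
    have "{x \<in> ?P. S q \<subseteq> fst x \<and> T q \<subseteq> snd x}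
        = {R. S q \<subseteq> R \<and> R \<subseteq> V \<and> card R = k} \<times> {F. T q \<subseteq> F \<and> F \<subseteq> V \<and> card F = l}"
      by (auto simp: size_pairs_def)
    then have "card {x \<in> ?P. S q \<subseteq> fst x \<and> T q \<subseteq> snd x} * ?n ^ (s + t)
        = (card {R. S q \<subseteq> R \<and> R \<subseteq> V \<and> card R = k} * ?n ^ s)
          * (card {F. T q \<subseteq> F \<and> F \<subseteq> V \<and> card F = l} * ?n ^ t)"
      by (simp add: card_cartesian_product power_add)
    also have "\<dots> \<le> ((?n choose k) * k ^ s) * ((?n choose l) * l ^ t)"
      using card_supersets[OF fin(1), of "S q" k] card_supersets[OF fin(1), of "T q" l] Q[OF that]
      by (auto dest: mult_le_mono)
    finally show ?thesis
      by (simp add: card_size_pairs fin ac_simps)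
  qed
  have "?N = (\<Sum>x\<in>?P. \<Sum>q\<in>Q. if S q \<subseteq> fst x \<and> T q \<subseteq> snd x then 1 else 0)"
    using fin by (intro sum.cong) (auto simp: sum.If_cases Int_def)
  also have "\<dots> = (\<Sum>q\<in>Q. card {x \<in> ?P. S q \<subseteq> fst x \<and> T q \<subseteq> snd x})"
    using finite_size_pairs[OF fin(1)]
    by (subst sum.swap, intro sum.cong) (auto simp: sum.If_cases Int_def)
  finally have "?N * ?n ^ (s + t)
      = (\<Sum>q\<in>Q. card {x \<in> ?P. S q \<subseteq> fst x \<and> T q \<subseteq> snd x} * ?n ^ (s + t))"
    by (simp add: sum_distrib_right)
  also have "\<dots> \<le> (\<Sum>q\<in>Q. k ^ s * l ^ t * card ?P)"
    by (rule sum_mono[OF one])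
  finally have "?n * (?N * ?n ^ (s + t)) \<le> ?n * (card Q * (k ^ s * l ^ t * card ?P))"
    by (intro mult_le_mono2) simp
  also have "\<dots> = (card Q * ?n) * (k ^ s * l ^ t * card ?P)"
    by (simp add: ac_simps)
  also have "\<dots> \<le> (c * ?n ^ (s + t)) * (k ^ s * l ^ t * card ?P)"
    by (rule mult_le_mono1[OF few])
  finally have "?n ^ (s + t) * (?n * ?N) \<le> ?n ^ (s + t) * (c * k ^ s * l ^ t * card ?P)"
    by (simp only: ac_simps)
  then show ?thesis
    using fin ne by (simp add: card_gt_0_iff)
qed


section \<open>Coincidences between sums and differences\<close>

definition off_diagonal :: "'a set \<Rightarrow> ('a \<times> 'a) set"
  where "off_diagonal R = {(a, b) \<in> R \<times> R. a \<noteq> b}"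

text \<open>Coincidences are recorded as quadruples, where the first two entries belong to rotations and the
  last two to reflections; in \<open>sum_quads\<close> below all four belong to rotations.\<close>

definition left_pair :: "'a \<times> 'a \<times> 'a \<times> 'a \<Rightarrow> 'a set"
  where "left_pair = (\<lambda>(r, s, f, g). {r, s})"

definition right_pair :: "'a \<times> 'a \<times> 'a \<times> 'a \<Rightarrow> 'a set"
  where "right_pair = (\<lambda>(r, s, f, g). {f, g})"

definition count_in :: "('a \<times> 'a \<times> 'a \<times> 'a) set \<Rightarrow> 'a set \<Rightarrow> 'a set \<Rightarrow> nat"
  where "count_in Q R F = card {q \<in> Q. left_pair q \<subseteq> R \<and> right_pair q \<subseteq> F}"

context comm_group
begin

definition sum_quads :: "('a \<times> 'a \<times> 'a \<times> 'a) set"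
  where "sum_quads = {(a, b, c, d). {a, b, c, d} \<subseteq> carrier G \<and> a \<otimes> b = c \<otimes> d
    \<and> a \<noteq> b \<and> c \<noteq> d \<and> a \<noteq> c \<and> a \<noteq> d \<and> b \<noteq> c \<and> b \<noteq> d}"

definition diff_quads :: "('a \<times> 'a \<times> 'a \<times> 'a) set"
  where "diff_quads = {(r, s, f, g). {r, s, f, g} \<subseteq> carrier G \<and> f \<otimes> inv r = g \<otimes> inv s
    \<and> r \<noteq> s \<and> f \<noteq> g}"

text \<open>The equation \<open>r s = f g\<inverse>\<close> describes two kinds of coincidence: a product of two rotations that is
  also a quotient of two reflections, and, rewritten as \<open>f r\<inverse> = g s\<close>, an element of \<open>F R\<inverse>\<close> that
  lies in \<open>F R\<close>. Degenerate solutions are separated out, since they consist of fewer distinct elements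
  and hence are contained in a random set with a different probability.\<close>

definition mixed_quads :: "bool \<Rightarrow> bool \<Rightarrow> ('a \<times> 'a \<times> 'a \<times> 'a) set"
  where "mixed_quads e e' = {(r, s, f, g). {r, s, f, g} \<subseteq> carrier G \<and> r \<otimes> s = f \<otimes> inv g
    \<and> (r = s) = e \<and> (f = g) = e'}"

text \<open>The factor \<open>2\<close> reflects the two roles of the equation \<open>r s = f g\<inverse>\<close>; its degenerate solutions
  occur in the second role only.\<close>

definition coincidences :: "'a set \<Rightarrow> 'a set \<Rightarrow> nat"
  where "coincidences R F = count_in sum_quads R R + count_in diff_quads R F
    + 2 * count_in (mixed_quads False False) R F + count_in (mixed_quads True False) R F
    + count_in (mixed_quads False True) R F + count_in (mixed_quads True True) R F"

definition prods :: "'a set \<Rightarrow> 'a set \<Rightarrow> 'a set"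
  where "prods A B = (\<lambda>(x, y). x \<otimes> y) ` (A \<times> B)"

definition quots :: "'a set \<Rightarrow> 'a set \<Rightarrow> 'a set"
  where "quots A B = (\<lambda>(x, y). x \<otimes> inv y) ` (A \<times> B)"

lemma mem_prods_iff: "x \<in> prods A B \<longleftrightarrow> (\<exists>a\<in>A. \<exists>b\<in>B. x = a \<otimes> b)"
  by (auto simp: prods_def)

lemma mem_quots_iff: "x \<in> quots A B \<longleftrightarrow> (\<exists>a\<in>A. \<exists>b\<in>B. x = a \<otimes> inv b)"
  by (auto simp: quots_def)

lemma finite_count_in:
  assumes "finite R" "finite F"
  shows "finite {q \<in> Q. left_pair q \<subseteq> R \<and> right_pair q \<subseteq> F}"
  by (rule finite_subset[of _ "R \<times> R \<times> F \<times> F"])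
    (use assms in \<open>auto simp: left_pair_def right_pair_def\<close>)

lemma mult_eq_mult_inv_iff:
  assumes "r \<in> carrier G" "s \<in> carrier G" "f \<in> carrier G" "g \<in> carrier G"
  shows "f \<otimes> inv r = g \<otimes> s \<longleftrightarrow> r \<otimes> s = f \<otimes> inv g"
proof -
  have "f \<otimes> inv r = g \<otimes> s \<longleftrightarrow> f = g \<otimes> s \<otimes> r"
    using assms inv_solve_right'[of "g \<otimes> s" f r] by auto
  also have "g \<otimes> s \<otimes> r = (r \<otimes> s) \<otimes> g"
    using assms by (simp add: m_ac)
  also have "f = (r \<otimes> s) \<otimes> g \<longleftrightarrow> r \<otimes> s = f \<otimes> inv g"
    using assms inv_solve_right[of "r \<otimes> s" f g] by auto
  finally show ?thesis .
qed

context
  fixes R F :: "'a set"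
  assumes R: "finite R" "R \<subseteq> carrier G" and F: "finite F" "F \<subseteq> carrier G"
begin

text \<open>Products of distinct elements coincide as \<open>a b = b a\<close>, whence the factor \<open>2\<close>. Squares are left out on
  purpose: by cancellation, any further coincidence between products of distinct elements involves
  four distinct elements.\<close>

lemma card_off_diagonal_le_prods:
  "card (off_diagonal R) \<le> 2 * card ((\<lambda>(a, b). a \<otimes> b) ` off_diagonal R) + count_in sum_quads R R"
proof -
  define E where "E = (\<lambda>(a, b). {(a, b), (b, a)} :: ('a \<times> 'a) set)"
  have fin: "finite (off_diagonal R)"
    using R by (auto simp: off_diagonal_def intro: finite_subset[of _ "R \<times> R"])
  have "card (E q) \<le> 2" for q
    using card_length[of "[q, (snd q, fst q)]"] by (simp add: E_def split_def)
  then have "card (off_diagonal R) \<le> 2 * card ((\<lambda>(a, b). a \<otimes> b) ` off_diagonal R)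
      + card {(p, q) \<in> off_diagonal R \<times> off_diagonal R. p \<notin> E q
          \<and> (case p of (a, b) \<Rightarrow> a \<otimes> b) = (case q of (a, b) \<Rightarrow> a \<otimes> b)}"
    by (intro card_le_collisions fin conjI) (simp_all add: E_def split: prod.split)
  also have "card {(p, q) \<in> off_diagonal R \<times> off_diagonal R. p \<notin> E q
          \<and> (case p of (a, b) \<Rightarrow> a \<otimes> b) = (case q of (a, b) \<Rightarrow> a \<otimes> b)} \<le> count_in sum_quads R R"
    unfolding count_in_def
  proof (rule card_inj_on_le[of "\<lambda>((a, b), (c, d)). (a, b, c, d)"])
    show "(\<lambda>((a, b), (c, d)). (a, b, c, d)) ` {(p, q) \<in> off_diagonal R \<times> off_diagonal R. p \<notin> E q
          \<and> (case p of (a, b) \<Rightarrow> a \<otimes> b) = (case q of (a, b) \<Rightarrow> a \<otimes> b)}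
        \<subseteq> {q \<in> sum_quads. left_pair q \<subseteq> R \<and> right_pair q \<subseteq> R}"
    proof (rule subsetI)
      fix x
      assume "x \<in> (\<lambda>((a, b), (c, d)). (a, b, c, d)) ` {(p, q) \<in> off_diagonal R \<times> off_diagonal R. p \<notin> E q
          \<and> (case p of (a, b) \<Rightarrow> a \<otimes> b) = (case q of (a, b) \<Rightarrow> a \<otimes> b)}"
      then obtain a b c d where x: "x = (a, b, c, d)"
        and mem: "a \<in> R" "b \<in> R" "c \<in> R" "d \<in> R" and ne: "a \<noteq> b" "c \<noteq> d"
        and "(a, b) \<notin> E (c, d)" and eq: "a \<otimes> b = c \<otimes> d"
        by (auto simp: off_diagonal_def)
      then have E: "\<not> (a = c \<and> b = d)" "\<not> (a = d \<and> b = c)"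
        by (auto simp: E_def)
      have G: "a \<in> carrier G" "b \<in> carrier G" "c \<in> carrier G" "d \<in> carrier G"
        using mem R by auto
      have eq': "b \<otimes> a = c \<otimes> d" "a \<otimes> b = d \<otimes> c"
        using eq G by (simp_all add: m_comm)
      have "a \<noteq> c" "a \<noteq> d" "b \<noteq> c" "b \<noteq> d"
        using E eq eq' G by (metis l_cancel)+
      then show "x \<in> {q \<in> sum_quads. left_pair q \<subseteq> R \<and> right_pair q \<subseteq> R}"
        using mem ne G eq by (simp add: x sum_quads_def left_pair_def right_pair_def)
    qed
  qed (use R in \<open>auto simp: inj_on_def finite_count_in\<close>)
  finally show ?thesis
    by simp
qed

text \<open>The summand \<open>1\<close> pays for the identity, which lies in \<open>F F\<inverse>\<close> for trivial reasons.\<close>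

lemma card_prods_Int_quots_le:
  "card ((\<lambda>(a, b). a \<otimes> b) ` off_diagonal R \<inter> quots F F)
    \<le> 1 + count_in (mixed_quads False False) R F"
proof -
  let ?I = "(\<lambda>(a, b). a \<otimes> b) ` off_diagonal R"
    and ?J = "(\<lambda>(a, b). a \<otimes> inv b) ` off_diagonal F"
  have fin: "finite (off_diagonal R)" "finite (off_diagonal F)"
    using R F by (auto simp: off_diagonal_def intro: finite_subset[of _ "R \<times> R"] finite_subset[of _ "F \<times> F"])
  have "quots F F \<subseteq> insert \<one> ?J"
  proof (clarsimp simp: quots_def)
    fix f g assume fg: "f \<in> F" "g \<in> F" "f \<otimes> inv g \<notin> ?J"
    then have "f = g"
      by (force simp: off_diagonal_def)
    then show "f \<otimes> inv g = \<one>"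
      using fg F by auto
  qed
  then have "card (?I \<inter> quots F F) \<le> card (insert \<one> (?I \<inter> ?J))"
    using fin by (intro card_mono) auto
  also have "\<dots> \<le> 1 + card (?I \<inter> ?J)"
    using fin by (simp add: card_insert_if)
  also have "card (?I \<inter> ?J) \<le> card {(p, q) \<in> off_diagonal R \<times> off_diagonal F.
      (case p of (a, b) \<Rightarrow> a \<otimes> b) = (case q of (a, b) \<Rightarrow> a \<otimes> inv b)}"
    by (rule card_image_Int_le[OF fin])
  also have "\<dots> \<le> count_in (mixed_quads False False) R F"
    unfolding count_in_def
    by (rule card_inj_on_le[of "\<lambda>((r, s), (f, g)). (r, s, f, g)"])
      (use R F in \<open>auto simp: inj_on_def off_diagonal_def mixed_quads_def
        left_pair_def right_pair_def intro: finite_subset[of _ "R \<times> R \<times> F \<times> F"]\<close>)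
  finally show ?thesis
    by simp
qed

lemma card_times_le_quots:
  "card F * card R \<le> card (quots F R) + count_in diff_quads R F"
proof -
  have "card (F \<times> R) \<le> 1 * card ((\<lambda>(f, r). f \<otimes> inv r) ` (F \<times> R))
      + card {(p, q) \<in> (F \<times> R) \<times> (F \<times> R). p \<notin> {q}
          \<and> (case p of (f, r) \<Rightarrow> f \<otimes> inv r) = (case q of (f, r) \<Rightarrow> f \<otimes> inv r)}"
    using R F by (intro card_le_collisions) auto
  also have "card {(p, q) \<in> (F \<times> R) \<times> (F \<times> R). p \<notin> {q}
          \<and> (case p of (f, r) \<Rightarrow> f \<otimes> inv r) = (case q of (f, r) \<Rightarrow> f \<otimes> inv r)}
      \<le> count_in diff_quads R F"
    unfolding count_in_def
  proof (rule card_inj_on_le[of "\<lambda>((f, r), (g, s)). (r, s, f, g)"])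
    show "(\<lambda>((f, r), (g, s)). (r, s, f, g)) ` {(p, q) \<in> (F \<times> R) \<times> (F \<times> R). p \<notin> {q}
          \<and> (case p of (f, r) \<Rightarrow> f \<otimes> inv r) = (case q of (f, r) \<Rightarrow> f \<otimes> inv r)}
        \<subseteq> {q \<in> diff_quads. left_pair q \<subseteq> R \<and> right_pair q \<subseteq> F}"
    proof (rule subsetI)
      fix x
      assume "x \<in> (\<lambda>((f, r), (g, s)). (r, s, f, g)) ` {(p, q) \<in> (F \<times> R) \<times> (F \<times> R). p \<notin> {q}
          \<and> (case p of (f, r) \<Rightarrow> f \<otimes> inv r) = (case q of (f, r) \<Rightarrow> f \<otimes> inv r)}"
      then obtain f r g s where x: "x = (r, s, f, g)" and mem: "f \<in> F" "r \<in> R" "g \<in> F" "s \<in> R"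
        and eq: "f \<otimes> inv r = g \<otimes> inv s" and ne: "(f, r) \<noteq> (g, s)"
        by auto
      have G: "f \<in> carrier G" "r \<in> carrier G" "g \<in> carrier G" "s \<in> carrier G"
        using mem R F by auto
      have "r \<noteq> s"
        using eq ne G by auto
      moreover have "f \<noteq> g"
        using eq ne G inv_inv[of r] inv_inv[of s] by (metis inv_closed l_cancel)
      ultimately show "x \<in> {q \<in> diff_quads. left_pair q \<subseteq> R \<and> right_pair q \<subseteq> F}"
        using mem G eq by (simp add: x diff_quads_def left_pair_def right_pair_def)
    qed
  qed (use R F in \<open>auto simp: inj_on_def finite_count_in\<close>)
  finally show ?thesis
    by (simp add: quots_def card_cartesian_product)
qed

lemma card_quots_Int_prods_le:
  "card (quots F R \<inter> prods F R)
    \<le> count_in (mixed_quads False False) R F + count_in (mixed_quads True False) R F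
      + count_in (mixed_quads False True) R F + count_in (mixed_quads True True) R F"
proof -
  let ?K = "\<lambda>e e'. {q \<in> mixed_quads e e'. left_pair q \<subseteq> R \<and> right_pair q \<subseteq> F}"
  have "card (quots F R \<inter> prods F R) \<le> card {(p, q) \<in> (F \<times> R) \<times> (F \<times> R).
      (case p of (f, r) \<Rightarrow> f \<otimes> inv r) = (case q of (f, r) \<Rightarrow> f \<otimes> r)}"
    unfolding quots_def prods_def using R F by (intro card_image_Int_le) auto
  also have "\<dots> \<le> card (?K False False \<union> ?K True False \<union> ?K False True \<union> ?K True True)"
  proof (rule card_inj_on_le[of "\<lambda>((f, r), (g, s)). (r, s, f, g)"])
    show "(\<lambda>((f, r), (g, s)). (r, s, f, g)) ` {(p, q) \<in> (F \<times> R) \<times> (F \<times> R).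
          (case p of (f, r) \<Rightarrow> f \<otimes> inv r) = (case q of (f, r) \<Rightarrow> f \<otimes> r)}
        \<subseteq> ?K False False \<union> ?K True False \<union> ?K False True \<union> ?K True True"
    proof (rule subsetI)
      fix x
      assume "x \<in> (\<lambda>((f, r), (g, s)). (r, s, f, g)) ` {(p, q) \<in> (F \<times> R) \<times> (F \<times> R).
          (case p of (f, r) \<Rightarrow> f \<otimes> inv r) = (case q of (f, r) \<Rightarrow> f \<otimes> r)}"
      then obtain f r g s where x: "x = (r, s, f, g)"
        and mem: "f \<in> F" "r \<in> R" "g \<in> F" "s \<in> R" and eq: "f \<otimes> inv r = g \<otimes> s"
        by auto
      have G: "r \<in> carrier G" "s \<in> carrier G" "f \<in> carrier G" "g \<in> carrier G"
        using mem R F by auto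
      then have "x \<in> ?K (r = s) (f = g)"
        using mem mult_eq_mult_inv_iff[OF G, THEN iffD1, OF eq]
        by (simp add: x mixed_quads_def left_pair_def right_pair_def)
      then show "x \<in> ?K False False \<union> ?K True False \<union> ?K False True \<union> ?K True True"
        by (cases "r = s"; cases "f = g") auto
    qed
    show "inj_on (\<lambda>((f, r), (g, s)). (r, s, f, g)) {(p, q) \<in> (F \<times> R) \<times> (F \<times> R).
          (case p of (f, r) \<Rightarrow> f \<otimes> inv r) = (case q of (f, r) \<Rightarrow> f \<otimes> r)}"
      by (auto simp: inj_on_def)
    show "finite (?K False False \<union> ?K True False \<union> ?K False True \<union> ?K True True)"
      using R F by (simp add: finite_count_in)
  qed
  also have "\<dots> \<le> card (?K False False) + card (?K True False) + card (?K False True) + card (?K True True)"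
    using card_Un_le[of "?K False False \<union> ?K True False \<union> ?K False True" "?K True True"]
      card_Un_le[of "?K False False \<union> ?K True False" "?K False True"]
      card_Un_le[of "?K False False" "?K True False"] by linarith
  finally show ?thesis
    by (simp add: count_in_def)
qed

text \<open>The inclusion-exclusion balance of rotations and reflections, doubled to avoid fractions. Products of
  distinct rotations make up at least \<open>(k\<^sup>2 - k) / 2\<close> rotations and \<open>F R\<inverse>\<close> at least \<open>k l\<close> reflections,
  both up to coincidences, while \<open>R R\<inverse>\<close> adds to \<open>F F\<inverse>\<close> at most \<open>k\<^sup>2 - k\<close> rotations, because the
  identity is already there when \<open>F\<close> is nonempty.\<close>

lemma differences_le_sums_plus_coincidences:
  assumes "F \<noteq> {}"
  shows "2 * (card (quots R R \<union> quots F F) + card (prods F R)) + 2 * card R * card F + card R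
    \<le> 2 * (card (prods R R \<union> quots F F) + card (prods F R \<union> quots F R))
      + card R * card R + 2 + 2 * coincidences R F"
proof -
  let ?O = "off_diagonal R" and ?I = "(\<lambda>(a, b). a \<otimes> b) ` off_diagonal R"
  have finO: "finite ?O"
    using R by (auto simp: off_diagonal_def intro: finite_subset[of _ "R \<times> R"])
  have fin: "finite (prods R R)" "finite (prods F R)" "finite (quots F R)" "finite (quots F F)"
    using R F by (auto simp: prods_def quots_def)
  have diag: "card ?O + card R = card R * card R"
    unfolding off_diagonal_def by (rule card_off_diagonal[OF R(1)])
  obtain f where f: "f \<in> F"
    using assms by auto
  have "\<one> \<in> quots F F"
    using f F by (force simp: quots_def)
  then have "quots R R \<union> quots F F \<subseteq> (\<lambda>(a, b). a \<otimes> inv b) ` ?O \<union> quots F F"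
    using R by (force simp: quots_def off_diagonal_def)
  then have "card (quots R R \<union> quots F F) \<le> card ((\<lambda>(a, b). a \<otimes> inv b) ` ?O \<union> quots F F)"
    using finO fin by (intro card_mono) auto
  also have "\<dots> \<le> card ((\<lambda>(a, b). a \<otimes> inv b) ` ?O) + card (quots F F)"
    by (rule card_Un_le)
  finally have 1: "card (quots R R \<union> quots F F) \<le> card ?O + card (quots F F)"
    using card_image_le[OF finO, of "\<lambda>(a, b). a \<otimes> inv b"] by linarith
  have "card (?I \<union> quots F F) \<le> card (prods R R \<union> quots F F)"
    using fin by (intro card_mono) (auto simp: prods_def off_diagonal_def)
  moreover have "card ?I + card (quots F F) = card (?I \<union> quots F F) + card (?I \<inter> quots F F)"
    using finO fin by (intro card_Un_Int) auto
  ultimately have 2: "card ?I + card (quots F F)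
      \<le> card (prods R R \<union> quots F F) + 1 + count_in (mixed_quads False False) R F"
    using card_prods_Int_quots_le by linarith
  have 3: "card (quots F R) + card (prods F R)
      = card (prods F R \<union> quots F R) + card (quots F R \<inter> prods F R)"
    using card_Un_Int[OF fin(3,2)] by (simp add: Un_commute)
  show ?thesis
    using 1 2 3 diag card_off_diagonal_le_prods card_times_le_quots card_quots_Int_prods_le
    unfolding coincidences_def by (simp add: mult.commute[of "card F" "card R"])
qed

end

text \<open>In each equation some unknown is determined by the others, so the number of solutions has one factor
  of the group order fewer than there are unknowns.\<close>

lemma card_sum_quads_le:
  assumes "finite (carrier G)"
  shows "card sum_quads \<le> order G ^ 3"
proof -
  have "card sum_quads \<le> card (carrier G \<times> carrier G \<times> carrier G)"
    by (rule card_inj_on_le[of "\<lambda>(a, b, c, d). (a, b, c)"])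
      (use assms in \<open>auto simp: inj_on_def sum_quads_def\<close>)
  then show ?thesis
    by (simp add: order_def card_cartesian_product power3_eq_cube)
qed

lemma card_diff_quads_le:
  assumes "finite (carrier G)"
  shows "card diff_quads \<le> order G ^ 3"
proof -
  have "card diff_quads \<le> card (carrier G \<times> carrier G \<times> carrier G)"
  proof (rule card_inj_on_le[of "\<lambda>(r, s, f, g). (r, s, g)"])
    show "inj_on (\<lambda>(r, s, f, g). (r, s, g)) diff_quads"
      by (auto simp: inj_on_def diff_quads_def) (metis inv_closed r_cancel)
  qed (use assms in \<open>auto simp: diff_quads_def\<close>)
  then show ?thesis
    by (simp add: order_def card_cartesian_product power3_eq_cube)
qed

text \<open>The solutions with \<open>r = s\<close> and \<open>f = g\<close> satisfy \<open>r r = \<one>\<close>; this is where the number of elements of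
  order at most \<open>2\<close> enters.\<close>

lemma card_mixed_quads_le:
  assumes fin: "finite (carrier G)"
  shows "card (mixed_quads False False) \<le> order G ^ 3"
    and "card (mixed_quads True False) \<le> order G ^ 2"
    and "card (mixed_quads False True) \<le> order G ^ 2"
    and "card (mixed_quads True True) \<le> num_ord_le_2 G * order G"
proof -
  have "card (mixed_quads False False) \<le> card (carrier G \<times> carrier G \<times> carrier G)"
    by (rule card_inj_on_le[of "\<lambda>(r, s, f, g). (r, s, g)"])
      (use fin in \<open>auto simp: inj_on_def mixed_quads_def\<close>)
  then show "card (mixed_quads False False) \<le> order G ^ 3"
    by (simp add: order_def card_cartesian_product power3_eq_cube)
  have "card (mixed_quads True False) \<le> card (carrier G \<times> carrier G)"
    by (rule card_inj_on_le[of "\<lambda>(r, s, f, g). (r, g)"])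
      (use fin in \<open>auto simp: inj_on_def mixed_quads_def\<close>)
  then show "card (mixed_quads True False) \<le> order G ^ 2"
    by (simp add: order_def card_cartesian_product power2_eq_square)
  have "card (mixed_quads False True) \<le> card (carrier G \<times> carrier G)"
  proof (rule card_inj_on_le[of "\<lambda>(r, s, f, g). (r, f)"])
    show "inj_on (\<lambda>(r, s, f, g). (r, f)) (mixed_quads False True)"
      by (auto simp: inj_on_def mixed_quads_def) (metis l_cancel)
  qed (use fin in \<open>auto simp: mixed_quads_def\<close>)
  then show "card (mixed_quads False True) \<le> order G ^ 2"
    by (simp add: order_def card_cartesian_product power2_eq_square)
  have "card (mixed_quads True True) \<le> card ({x \<in> carrier G. ord x \<le> 2} \<times> carrier G)"
  proof (rule card_inj_on_le[of "\<lambda>(r, s, f, g). (r, f)"])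
    have "ord r \<le> 2" if r: "r \<in> carrier G" "r \<otimes> r = \<one>" for r
    proof -
      have "r [^] (2::nat) = \<one>"
        using r by (simp add: numeral_2_eq_2)
      then show ?thesis
        using r pow_eq_id[of r 2] dvd_imp_le by auto
    qed
    then show "(\<lambda>(r, s, f, g). (r, f)) ` mixed_quads True True
        \<subseteq> {x \<in> carrier G. ord x \<le> 2} \<times> carrier G"
      by (auto simp: mixed_quads_def)
  qed (use fin in \<open>auto simp: inj_on_def mixed_quads_def\<close>)
  then show "card (mixed_quads True True) \<le> num_ord_le_2 G * order G"
    by (simp add: order_def card_cartesian_product num_ord_le_2_def)
qed

text \<open>The mean number of coincidences. The exponents of \<open>k\<close> and \<open>l\<close> are the numbers of distinct rotations
  and reflections in the respective kind of quadruple.\<close>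

lemma sum_coincidences_le:
  fixes k l :: nat
  assumes fin: "finite (carrier G)"
  shows "order G * (\<Sum>(R, F)\<in>size_pairs (carrier G) k l. coincidences R F)
    \<le> (k ^ 4 + 3 * k ^ 2 * l ^ 2 + k * l ^ 2 + k ^ 2 * l + num_ord_le_2 G * k * l)
      * card (size_pairs (carrier G) k l)"
proof -
  let ?P = "size_pairs (carrier G) k l" and ?n = "order G" and ?j = "num_ord_le_2 G"
  have ne: "carrier G \<noteq> {}"
    by auto
  have finQ: "finite Q" if "Q \<subseteq> carrier G \<times> carrier G \<times> carrier G \<times> carrier G" for Q
    by (rule finite_subset[OF that]) (use fin in auto)
  have sub: "sum_quads \<subseteq> carrier G \<times> carrier G \<times> carrier G \<times> carrier G"
    "diff_quads \<subseteq> carrier G \<times> carrier G \<times> carrier G \<times> carrier G"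
    "mixed_quads e e' \<subseteq> carrier G \<times> carrier G \<times> carrier G \<times> carrier G" for e e'
    by (auto simp: sum_quads_def diff_quads_def mixed_quads_def)
  have count: "?n * (\<Sum>(R, F)\<in>?P. count_in Q R F) \<le> c * k ^ s * l ^ t * card ?P"
    if "Q \<subseteq> carrier G \<times> carrier G \<times> carrier G \<times> carrier G" "card Q * ?n \<le> c * ?n ^ (s + t)"
      "\<And>q. q \<in> Q \<Longrightarrow> card (left_pair q) = s \<and> card (right_pair q) = t" for Q c s t
  proof -
    have "left_pair q \<subseteq> carrier G \<and> right_pair q \<subseteq> carrier G \<and> card (left_pair q) = s
        \<and> card (right_pair q) = t" if "q \<in> Q" for q
      using \<open>Q \<subseteq> _\<close> that \<open>\<And>q. q \<in> Q \<Longrightarrow> card (left_pair q) = s \<and> card (right_pair q) = t\<close>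
      by (auto simp: left_pair_def right_pair_def)
    then show ?thesis
      using sum_card_patterns_le[OF fin finQ[OF that(1)] ne, of left_pair right_pair s t c k l] that(2)
      by (simp add: count_in_def order_def)
  qed
  have "?n * (\<Sum>(R, F)\<in>?P. card {q \<in> sum_quads. left_pair q \<union> right_pair q \<subseteq> R \<and> {} \<subseteq> F})
      \<le> 1 * k ^ 4 * l ^ 0 * card ?P"
    unfolding order_def
  proof (rule sum_card_patterns_le[OF fin finQ[OF sub(1)] ne])
    show "card sum_quads * card (carrier G) \<le> 1 * card (carrier G) ^ (4 + 0)"
      using mult_le_mono1[OF card_sum_quads_le[OF fin], of "order G"]
      by (simp add: order_def numeral_eq_Suc ac_simps)
  qed (auto simp: sum_quads_def left_pair_def right_pair_def)
  then have 1: "?n * (\<Sum>(R, F)\<in>?P. count_in sum_quads R R) \<le> k ^ 4 * card ?P"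
    by (simp add: count_in_def)
  have 2: "?n * (\<Sum>(R, F)\<in>?P. count_in diff_quads R F) \<le> 1 * k ^ 2 * l ^ 2 * card ?P"
    using mult_le_mono1[OF card_diff_quads_le[OF fin], of "order G"]
    by (intro count sub) (auto simp: diff_quads_def left_pair_def right_pair_def numeral_eq_Suc ac_simps)
  have 3: "?n * (\<Sum>(R, F)\<in>?P. count_in (mixed_quads False False) R F) \<le> 1 * k ^ 2 * l ^ 2 * card ?P"
    using mult_le_mono1[OF card_mixed_quads_le(1)[OF fin], of "order G"]
    by (intro count sub) (auto simp: mixed_quads_def left_pair_def right_pair_def numeral_eq_Suc ac_simps)
  have 4: "?n * (\<Sum>(R, F)\<in>?P. count_in (mixed_quads True False) R F) \<le> 1 * k ^ 1 * l ^ 2 * card ?P"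
    using mult_le_mono1[OF card_mixed_quads_le(2)[OF fin], of "order G"]
    by (intro count sub) (auto simp: mixed_quads_def left_pair_def right_pair_def numeral_eq_Suc ac_simps)
  have 5: "?n * (\<Sum>(R, F)\<in>?P. count_in (mixed_quads False True) R F) \<le> 1 * k ^ 2 * l ^ 1 * card ?P"
    using mult_le_mono1[OF card_mixed_quads_le(3)[OF fin], of "order G"]
    by (intro count sub) (auto simp: mixed_quads_def left_pair_def right_pair_def numeral_eq_Suc ac_simps)
  have 6: "?n * (\<Sum>(R, F)\<in>?P. count_in (mixed_quads True True) R F) \<le> ?j * k ^ 1 * l ^ 1 * card ?P"
    using mult_le_mono1[OF card_mixed_quads_le(4)[OF fin], of "order G"]
    by (intro count sub) (auto simp: mixed_quads_def left_pair_def right_pair_def numeral_eq_Suc ac_simps)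
  have "(\<Sum>(R, F)\<in>?P. coincidences R F) = (\<Sum>(R, F)\<in>?P. count_in sum_quads R R)
      + (\<Sum>(R, F)\<in>?P. count_in diff_quads R F)
      + 2 * (\<Sum>(R, F)\<in>?P. count_in (mixed_quads False False) R F)
      + (\<Sum>(R, F)\<in>?P. count_in (mixed_quads True False) R F)
      + (\<Sum>(R, F)\<in>?P. count_in (mixed_quads False True) R F)
      + (\<Sum>(R, F)\<in>?P. count_in (mixed_quads True True) R F)"
    by (simp add: coincidences_def split_def sum.distrib sum_distrib_left)
  then show ?thesis
    using 1 2 3 4 5 6 by (simp add: algebra_simps)
qed


end

section \<open>Sumsets and difference sets in the generalized dihedral group\<close>

definition dihedral_set :: "'a set \<Rightarrow> 'a set \<Rightarrow> (int \<times> 'a) set"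
  where "dihedral_set R F = {0} \<times> R \<union> {1} \<times> F"
lemma mem_dihedral_set_iff: "(e, x) \<in> dihedral_set R F \<longleftrightarrow> e = 0 \<and> x \<in> R \<or> e = 1 \<and> x \<in> F"
  by (auto simp: dihedral_set_def)
lemma bex_dihedral_set_iff:
  "(\<exists>a\<in>dihedral_set R F. P a) \<longleftrightarrow> (\<exists>x\<in>R. P (0, x)) \<or> (\<exists>x\<in>F. P (1, x))"
  by (simp add: dihedral_set_def bex_Un)
lemma card_dihedral_set:
  assumes "finite R" "finite F" shows "card (dihedral_set R F) = card R + card F"
proof -
  have "card (dihedral_set R F) = card ({0::int} \<times> R) + card ({1::int} \<times> F)"
    unfolding dihedral_set_def using assms by (intro card_Un_disjoint finite_cartesian_product)
      (simp_all add: disjoint_iff)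
  then show ?thesis by (simp only: card_cartesian_product_singleton)
qed
lemma vimage_dihedral_set:
  "Pair 0 -` dihedral_set R F = R" "Pair 1 -` dihedral_set R F = F"
  by (simp_all add: vimage_def mem_dihedral_set_iff)

lemma dihedral_set_eq_iff: "dihedral_set R F = dihedral_set R' F' \<longleftrightarrow> R = R' \<and> F = F'"
  by (metis vimage_dihedral_set)
lemma carrier_gen_dihedral:
  "carrier (gen_dihedral G) = dihedral_set (carrier G) (carrier G)"
  by (auto simp: gen_dihedral_def semidirect_def mem_dihedral_set_iff carrier_integer_mod_group)

lemma dihedral_set_cases:
  assumes "A \<subseteq> carrier (gen_dihedral G)"
  obtains R F where "R \<subseteq> carrier G" "F \<subseteq> carrier G" "A = dihedral_set R F"
proof
  show "A = dihedral_set (Pair 0 -` A) (Pair 1 -` A)" "Pair 0 -` A \<subseteq> carrier G"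
    "Pair 1 -` A \<subseteq> carrier G"
    using assms by (auto simp: carrier_gen_dihedral mem_dihedral_set_iff)
qed

lemma gen_dihedral_mult:
  "(0, x) \<otimes>\<^bsub>gen_dihedral G\<^esub> (0, y) = (0, x \<otimes>\<^bsub>G\<^esub> y)"
  "(0, x) \<otimes>\<^bsub>gen_dihedral G\<^esub> (1, y) = (1, x \<otimes>\<^bsub>G\<^esub> y)"
  "(1, x) \<otimes>\<^bsub>gen_dihedral G\<^esub> (0, y) = (1, x \<otimes>\<^bsub>G\<^esub> inv\<^bsub>G\<^esub> y)"
  "(1, x) \<otimes>\<^bsub>gen_dihedral G\<^esub> (1, y) = (0, x \<otimes>\<^bsub>G\<^esub> inv\<^bsub>G\<^esub> y)"
  by (simp_all add: gen_dihedral_def semidirect_def)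

context comm_group
begin

lemma gen_dihedral_inv:
  assumes "x \<in> carrier G"
  shows "inv\<^bsub>gen_dihedral G\<^esub> (0, x) = (0, inv x)" "inv\<^bsub>gen_dihedral G\<^esub> (1, x) = (1, x)"
proof -
  interpret D: group "gen_dihedral G"
    by (rule group_gen_dihedral) (rule comm_group_axioms)
  have one: "\<one>\<^bsub>gen_dihedral G\<^esub> = (0, \<one>)"
    by (simp add: gen_dihedral_def semidirect_def)
  show "inv\<^bsub>gen_dihedral G\<^esub> (0, x) = (0, inv x)" "inv\<^bsub>gen_dihedral G\<^esub> (1, x) = (1, x)"
    using assms
    by (auto intro!: D.inv_equality simp: gen_dihedral_mult one carrier_gen_dihedral mem_dihedral_set_iff)
qed

text \<open>Conjugation by a reflection inverts rotations: this makes \<open>F R\<inverse>\<close> and \<open>F F\<inverse>\<close> appear among the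
  products.\<close>

lemma set_mult_dihedral_set:
  assumes "R \<subseteq> carrier G" "F \<subseteq> carrier G"
  shows "dihedral_set R F <#>\<^bsub>gen_dihedral G\<^esub> dihedral_set R F
    = dihedral_set (prods R R \<union> quots F F) (prods F R \<union> quots F R)"
proof (rule Set.set_eqI)
  fix p :: "int \<times> 'a"
  obtain e x where p: "p = (e, x)"
    by fastforce
  have comm: "x \<otimes> y = y \<otimes> x" if "x \<in> R" "y \<in> F" for x y
    using that assms m_comm by blast
  have "(e, x) \<in> dihedral_set R F <#>\<^bsub>gen_dihedral G\<^esub> dihedral_set R F \<longleftrightarrow>
      (\<exists>a\<in>dihedral_set R F. \<exists>b\<in>dihedral_set R F. (e, x) = a \<otimes>\<^bsub>gen_dihedral G\<^esub> b)"
    by (simp add: set_mult_def)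
  also have "\<dots> \<longleftrightarrow> e = 0 \<and> (\<exists>r\<in>R. \<exists>s\<in>R. x = r \<otimes> s) \<or> e = 1 \<and> (\<exists>r\<in>R. \<exists>f\<in>F. x = r \<otimes> f)
      \<or> e = 1 \<and> (\<exists>f\<in>F. \<exists>r\<in>R. x = f \<otimes> inv r) \<or> e = 0 \<and> (\<exists>f\<in>F. \<exists>g\<in>F. x = f \<otimes> inv g)"
    by (simp add: bex_dihedral_set_iff gen_dihedral_mult bex_disj_distrib)
      (cases "e = 0"; cases "e = 1"; simp; blast)
  also have "(\<exists>r\<in>R. \<exists>f\<in>F. x = r \<otimes> f) \<longleftrightarrow> (\<exists>r\<in>R. \<exists>f\<in>F. x = f \<otimes> r)"
    by (intro bex_cong refl arg_cong[where f = "(=) x"] comm)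
  also have "\<dots> \<longleftrightarrow> (\<exists>f\<in>F. \<exists>r\<in>R. x = f \<otimes> r)"
    by blast
  finally show "p \<in> dihedral_set R F <#>\<^bsub>gen_dihedral G\<^esub> dihedral_set R F
      \<longleftrightarrow> p \<in> dihedral_set (prods R R \<union> quots F F) (prods F R \<union> quots F R)"
    by (simp add: p mem_dihedral_set_iff mem_prods_iff mem_quots_iff)
      (cases "e = 0"; cases "e = 1"; simp)
qed

text \<open>Inverting the rotation on the right of a reflection undoes the inversion in the product, so both
  orders of a rotation and a reflection contribute the same set \<open>F R\<close>.\<close>

lemma diffset_dihedral_set:
  assumes "R \<subseteq> carrier G" "F \<subseteq> carrier G"
  shows "diffset (gen_dihedral G) (dihedral_set R F)
    = dihedral_set (quots R R \<union> quots F F) (prods F R)"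
proof (rule Set.set_eqI)
  fix p :: "int \<times> 'a"
  obtain e x where p: "p = (e, x)"
    by fastforce
  have comm: "x \<otimes> y = y \<otimes> x" if "x \<in> R" "y \<in> F" for x y
    using that assms m_comm by blast
  have inv_R: "inv\<^bsub>gen_dihedral G\<^esub> (0, r) = (0, inv r)" "inv (inv r) = r" if "r \<in> R" for r
    using that assms gen_dihedral_inv(1) by auto
  have inv_F: "inv\<^bsub>gen_dihedral G\<^esub> (1, f) = (1, f)" if "f \<in> F" for f
    using that assms gen_dihedral_inv(2) by auto
  have "(e, x) \<in> diffset (gen_dihedral G) (dihedral_set R F) \<longleftrightarrow>
      (\<exists>a\<in>dihedral_set R F. \<exists>b\<in>dihedral_set R F.
        (e, x) = a \<otimes>\<^bsub>gen_dihedral G\<^esub> inv\<^bsub>gen_dihedral G\<^esub> b)"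
    unfolding diffset_def by blast
  also have "\<dots> \<longleftrightarrow> e = 0 \<and> (\<exists>r\<in>R. \<exists>s\<in>R. x = r \<otimes> inv s) \<or> e = 1 \<and> (\<exists>r\<in>R. \<exists>f\<in>F. x = r \<otimes> f)
      \<or> e = 1 \<and> (\<exists>f\<in>F. \<exists>r\<in>R. x = f \<otimes> r) \<or> e = 0 \<and> (\<exists>f\<in>F. \<exists>g\<in>F. x = f \<otimes> inv g)"
    by (simp add: bex_dihedral_set_iff inv_R inv_F gen_dihedral_mult bex_disj_distrib cong: bex_cong)
      (cases "e = 0"; cases "e = 1"; simp; blast)
  also have "(\<exists>r\<in>R. \<exists>f\<in>F. x = r \<otimes> f) \<longleftrightarrow> (\<exists>r\<in>R. \<exists>f\<in>F. x = f \<otimes> r)"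
    by (intro bex_cong refl arg_cong[where f = "(=) x"] comm)
  also have "\<dots> \<longleftrightarrow> (\<exists>f\<in>F. \<exists>r\<in>R. x = f \<otimes> r)"
    by blast
  finally show "p \<in> diffset (gen_dihedral G) (dihedral_set R F)
      \<longleftrightarrow> p \<in> dihedral_set (quots R R \<union> quots F F) (prods F R)"
    by (simp add: p mem_dihedral_set_iff mem_prods_iff mem_quots_iff)
      (cases "e = 0"; cases "e = 1"; simp)
qed

lemma not_MSTD_imp_coincidences:
  assumes R: "finite R" "R \<subseteq> carrier G" and F: "finite F" "F \<subseteq> carrier G" "F \<noteq> {}"
    and not: "\<not> MSTD (gen_dihedral G) (dihedral_set R F)"
  shows "2 * card R * card F + card R \<le> card R * card R + 2 + 2 * coincidences R F"
proof -
  have fin: "finite (prods R R)" "finite (prods F R)" "finite (quots F R)" "finite (quots F F)"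
    "finite (quots R R)"
    using R F by (auto simp: prods_def quots_def)
  have "card (prods R R \<union> quots F F) + card (prods F R \<union> quots F R)
      \<le> card (quots R R \<union> quots F F) + card (prods F R)"
    using not R F fin
    by (simp add: MSTD_def set_mult_dihedral_set diffset_dihedral_set card_dihedral_set)
  then have "2 * (card (prods R R \<union> quots F F) + card (prods F R \<union> quots F R))
      \<le> 2 * (card (quots R R \<union> quots F F) + card (prods F R))"
    by (rule mult_le_mono2)
  with differences_le_sums_plus_coincidences[OF R F] show ?thesis
    by (simp only: add.assoc)
qed

text \<open>Reflections are involutions, so products and quotients of reflections agree.\<close>

lemma not_MDTS_if_no_rotations:
  assumes "F \<subseteq> carrier G"
  shows "\<not> MDTS (gen_dihedral G) (dihedral_set {} F)"
  using assms
  by (simp add: MDTS_def set_mult_dihedral_set diffset_dihedral_set prods_def quots_def)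

text \<open>Markov's inequality: each pair counted by \<open>B\<close> has at least as many coincidences as the surplus
  \<open>(k (2 l - k + 1) - 2) / 2\<close> of products over quotients that it has to destroy.\<close>

lemma card_not_MSTD_mult_margin_le:
  fixes k l :: nat
  assumes fin: "finite (carrier G)" and "0 < l"
  defines "B \<equiv> {(R, F) \<in> size_pairs (carrier G) k l. \<not> MSTD (gen_dihedral G) (dihedral_set R F)}"
  shows "real (order G) * (real k * (2 * real l - real k + 1) - 2) * real (card B)
    \<le> 2 * (real k ^ 4 + 3 * real k ^ 2 * real l ^ 2 + real k * real l ^ 2 + real k ^ 2 * real l
      + real (num_ord_le_2 G) * real k * real l) * real (card (size_pairs (carrier G) k l))"
proof -
  let ?P = "size_pairs (carrier G) k l"
  have finP: "finite ?P"
    by (rule finite_size_pairs[OF fin])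
  have sub: "B \<subseteq> ?P"
    by (auto simp: B_def)
  have "real k * (2 * real l - real k + 1) - 2 \<le> 2 * real (case x of (R, F) \<Rightarrow> coincidences R F)"
    if "x \<in> B" for x
  proof -
    obtain R F where x: "x = (R, F)"
      by fastforce
    have RF: "R \<subseteq> carrier G" "F \<subseteq> carrier G" "card R = k" "card F = l"
      "\<not> MSTD (gen_dihedral G) (dihedral_set R F)"
      using that by (auto simp: x B_def size_pairs_def)
    then have "2 * k * l + k \<le> k * k + 2 + 2 * coincidences R F"
      using not_MSTD_imp_coincidences[of R F] finite_subset[OF RF(1) fin]
        finite_subset[OF RF(2) fin] \<open>0 < l\<close> by (cases "F = {}") simp_all
    then have "real (2 * k * l + k) \<le> real (k * k + 2 + 2 * coincidences R F)"
      by (simp only: of_nat_le_iff)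
    then show ?thesis
      by (simp add: x algebra_simps)
  qed
  then have "(\<Sum>x\<in>B. real k * (2 * real l - real k + 1) - 2)
      \<le> (\<Sum>x\<in>B. 2 * real (case x of (R, F) \<Rightarrow> coincidences R F))"
    by (rule sum_mono)
  also have "\<dots> \<le> (\<Sum>x\<in>?P. 2 * real (case x of (R, F) \<Rightarrow> coincidences R F))"
    by (rule sum_mono2[OF finP sub]) simp
  also have "\<dots> = 2 * real (\<Sum>(R, F)\<in>?P. coincidences R F)"
    by (simp add: sum_distrib_left split_def)
  finally have "real (card B) * (real k * (2 * real l - real k + 1) - 2)
      \<le> 2 * real (\<Sum>(R, F)\<in>?P. coincidences R F)"
    by simp
  from mult_left_mono[OF this, of "real (order G)"]
  have "real (order G) * (real (card B) * (real k * (2 * real l - real k + 1) - 2))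
      \<le> real (order G) * (2 * real (\<Sum>(R, F)\<in>?P. coincidences R F))"
    by simp
  also have "\<dots> = 2 * real (order G * (\<Sum>(R, F)\<in>?P. coincidences R F))"
    by (simp only: of_nat_mult mult.left_commute)
  also have "\<dots> \<le> 2 * real ((k ^ 4 + 3 * k ^ 2 * l ^ 2 + k * l ^ 2 + k ^ 2 * l
      + num_ord_le_2 G * k * l) * card ?P)"
    using sum_coincidences_le[OF fin, of k l] by (simp only: of_nat_le_iff mult_le_cancel_left_pos)
  finally show ?thesis
    by (simp add: algebra_simps)
qed

end

lemma card_subsets_of_size_gen_dihedral:
  assumes fin: "finite (carrier G)"
  shows "card {A \<in> subsets_of_size (gen_dihedral G) m. P A}
    = (\<Sum>k\<le>m. card {(R, F) \<in> size_pairs (carrier G) k (m - k). P (dihedral_set R F)})"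
proof -
  let ?Q = "\<lambda>k. {(R, F) \<in> size_pairs (carrier G) k (m - k). P (dihedral_set R F)}"
  have finV: "finite S" if "S \<subseteq> carrier G" for S
    using that fin by (rule finite_subset)
  have "{A \<in> subsets_of_size (gen_dihedral G) m. P A} = (\<lambda>(R, F). dihedral_set R F) ` (\<Union>k\<le>m. ?Q k)"
  proof (intro equalityI subsetI)
    fix A assume A: "A \<in> {A \<in> subsets_of_size (gen_dihedral G) m. P A}"
    then have "A \<subseteq> carrier (gen_dihedral G)"
      by (simp add: subsets_of_size_def)
    then obtain R F where RF: "R \<subseteq> carrier G" "F \<subseteq> carrier G" "A = dihedral_set R F"
      by (rule dihedral_set_cases)
    then have "card R + card F = m"
      using A finV card_dihedral_set[of R F] by (simp add: subsets_of_size_def)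
    then have "card R \<le> m" "(R, F) \<in> ?Q (card R)"
      using A RF by (auto simp: size_pairs_def)
    then have "(R, F) \<in> (\<Union>k\<le>m. ?Q k)"
      by blast
    then show "A \<in> (\<lambda>(R, F). dihedral_set R F) ` (\<Union>k\<le>m. ?Q k)"
      unfolding RF(3) by (rule rev_image_eqI) simp
  next
    fix A assume "A \<in> (\<lambda>(R, F). dihedral_set R F) ` (\<Union>k\<le>m. ?Q k)"
    then obtain R F where RF: "R \<subseteq> carrier G" "F \<subseteq> carrier G" "A = dihedral_set R F"
      "card R + card F = m" "P A"
      by (auto simp: size_pairs_def)
    then have "card A = m" "A \<subseteq> carrier (gen_dihedral G)"
      using finV by (auto simp: card_dihedral_set carrier_gen_dihedral mem_dihedral_set_iff)
    then show "A \<in> {A \<in> subsets_of_size (gen_dihedral G) m. P A}"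
      using RF(5) by (simp add: subsets_of_size_def)
  qed
  moreover have "inj_on (\<lambda>(R, F). dihedral_set R F) (\<Union>k\<le>m. ?Q k)"
    by (auto simp: inj_on_def dihedral_set_eq_iff)
  ultimately have "card {A \<in> subsets_of_size (gen_dihedral G) m. P A} = card (\<Union>k\<le>m. ?Q k)"
    by (simp add: card_image)
  also have "\<dots> = (\<Sum>k\<le>m. card (?Q k))"
  proof (rule card_UN_disjoint)
    show "\<forall>k\<in>{..m}. finite (?Q k)"
      by (auto intro!: finite_subset[OF _ finite_size_pairs[OF fin]])
    show "\<forall>k\<in>{..m}. \<forall>k'\<in>{..m}. k \<noteq> k' \<longrightarrow> ?Q k \<inter> ?Q k' = {}"
      by (auto simp: size_pairs_def)
  qed simp
  finally show ?thesis .
qed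

section \<open>Numerical estimates\<close>

text \<open>The mean number of coincidences is at most \<open>1 / c\<close> of the surplus. The leading part of the mean is
  \<open>k / n\<close> times \<open>k\<^sup>3 + 3 k l\<^sup>2 = ((k + l)\<^sup>3 + (k - l)\<^sup>3) / 2\<close>, which is not much larger than
  \<open>(k + l)\<^sup>3 / 2\<close> unless \<open>k\<close> is much larger than \<open>l\<close>; this is measured by \<open>\<delta>\<close>. The surplus is of order \<open>\<sigma> k m\<close>
  with \<open>m = k + l\<close>. All terms are compared with \<open>m\<^sup>3\<close>, the lower order ones by means of \<open>m \<ge> 6\<close>.\<close>

lemma margin_dominates_coincidences:
  fixes k l j n c \<delta> \<sigma> :: real
  assumes nonneg: "0 \<le> k" "0 \<le> l" "0 \<le> j" "0 \<le> c" "0 \<le> \<sigma>" and m: "6 \<le> k + l"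
    and cube: "(k - l) ^ 3 \<le> \<delta> * (k + l) ^ 3"
    and s: "\<sigma> * (k + l) \<le> 2 * l - k + 1" "10 \<le> k * (2 * l - k + 1)"
    and n: "(k + l) ^ 2 * (111 + 5 * j) \<le> 2 * n"
    and c: "c * (5 / 4 * (1 + \<delta>) + 5 / 12) \<le> 111 / 2 * \<sigma>" "c * (5 / 72) \<le> 5 / 2 * \<sigma>"
  shows "c * (2 * (k ^ 4 + 3 * k ^ 2 * l ^ 2 + k * l ^ 2 + k ^ 2 * l + j * k * l))
    \<le> n * (k * (2 * l - k + 1) - 2)"
proof -
  define M where "M = k + l"
  define s where "s = 2 * l - k + 1"
  define e where "e = k ^ 3 + 3 * k * l ^ 2 + l * M + j * l"
  have M: "6 \<le> M" "0 \<le> M"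
    using m by (auto simp: M_def)
  have n0: "0 \<le> n"
  proof -
    have "0 \<le> M ^ 2 * (111 + 5 * j)"
      using nonneg by simp
    then show ?thesis
      using n by (simp add: M_def)
  qed
  have M1: "36 * M \<le> M ^ 3" and M2: "6 * M ^ 2 \<le> M ^ 3"
    using mult_right_mono[OF power_mono[OF M(1), of 2] M(2)] mult_right_mono[OF M(1), of "M ^ 2"]
    by (simp_all add: power2_eq_square power3_eq_cube)
  have "2 * (k ^ 3 + 3 * k * l ^ 2) = M ^ 3 + (k - l) ^ 3"
    by (simp add: M_def power2_eq_square power3_eq_cube algebra_simps)
  then have e1: "2 * (k ^ 3 + 3 * k * l ^ 2) \<le> (1 + \<delta>) * M ^ 3"
    using cube by (simp add: M_def algebra_simps)
  have "l * M \<le> M * M"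
    using nonneg by (intro mult_right_mono) (auto simp: M_def)
  then have e2: "6 * (l * M) \<le> M ^ 3"
    using M2 by (simp add: power2_eq_square)
  have e3: "j * (36 * l) \<le> j * M ^ 3"
    using nonneg M1 by (intro mult_left_mono) (auto simp: M_def)
  have "5 / 2 * e = 5 / 4 * (2 * (k ^ 3 + 3 * k * l ^ 2)) + 5 / 12 * (6 * (l * M)) + 5 / 72 * (j * (36 * l))"
    by (simp add: e_def algebra_simps)
  also have "\<dots> \<le> 5 / 4 * ((1 + \<delta>) * M ^ 3) + 5 / 12 * M ^ 3 + 5 / 72 * (j * M ^ 3)"
    by (intro add_mono mult_left_mono e1 e2 e3) simp_all
  also have "\<dots> = (5 / 4 * (1 + \<delta>) + 5 / 12 + 5 / 72 * j) * M ^ 3"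
    by (simp add: field_simps)
  finally have "c * (5 / 2 * e) \<le> c * ((5 / 4 * (1 + \<delta>) + 5 / 12 + 5 / 72 * j) * M ^ 3)"
    by (rule mult_left_mono) (rule nonneg)
  also have "\<dots> = (c * (5 / 4 * (1 + \<delta>) + 5 / 12) + c * (5 / 72) * j) * M ^ 3"
    by (simp add: algebra_simps)
  also have "\<dots> \<le> (111 / 2 * \<sigma> + 5 / 2 * \<sigma> * j) * M ^ 3"
    using c nonneg M by (intro mult_right_mono add_mono) auto
  also have "\<dots> = (M ^ 2 * (111 + 5 * j) / 2) * (\<sigma> * M)"
    by (simp add: field_simps power2_eq_square power3_eq_cube)
  also have "\<dots> \<le> n * (\<sigma> * M)"
    using n nonneg M by (intro mult_right_mono) (auto simp: M_def)
  also have "\<dots> \<le> n * s"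
    using s n0 by (intro mult_left_mono) (auto simp: M_def s_def)
  finally have ns: "c * (5 / 2 * e) \<le> n * s" .
  have "c * (2 * (k ^ 4 + 3 * k ^ 2 * l ^ 2 + k * l ^ 2 + k ^ 2 * l + j * k * l))
      = 4 / 5 * k * (c * (5 / 2 * e))"
    by (simp add: e_def M_def power2_eq_square power3_eq_cube power4_eq_xxxx algebra_simps)
  also have "\<dots> \<le> 4 / 5 * k * (n * s)"
    using ns nonneg by (intro mult_left_mono) auto
  also have "\<dots> = n * (4 / 5 * (k * s))"
    by simp
  also have "\<dots> \<le> n * (k * s - 2)"
    using s(2) n0 by (intro mult_left_mono) (auto simp: s_def)
  finally show ?thesis
    by (simp add: s_def)
qed

text \<open>The number of pairs of subsets with \<open>k\<close> and \<open>m - k\<close> elements increases up to \<open>k = m / 2\<close>; at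
  \<open>k = 0\<close> the lemma gives growth by a factor \<open>m\<close>.\<close>

lemma choose_mult_choose_step:
  assumes "m \<le> n" "2 * k + 1 \<le> m"
  shows "(m - k) * ((n choose k) * (n choose (m - k)))
    \<le> (k + 1) * ((n choose (k + 1)) * (n choose (m - (k + 1))))"
proof -
  define i where "i = m - (k + 1)"
  have i: "m - k = Suc i" "k \<le> i" "Suc i + k = m"
    using assms by (auto simp: i_def)
  have step: "Suc r * (n choose Suc r) = (n - r) * (n choose r)" if "r < n" for r
    using binomial_absorb_comp[of n r] binomial_absorption[of r n] by (simp add: ac_simps)
  have "(m - k) * ((n choose k) * (n choose (m - k))) = (n choose k) * (Suc i * (n choose Suc i))"
    by (simp only: i ac_simps)
  also have "\<dots> = (n choose k) * ((n - i) * (n choose i))"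
    using assms i by (simp only: step)
  also have "\<dots> \<le> (n choose k) * ((n - k) * (n choose i))"
    using i by (intro mult_le_mono2 mult_le_mono1) auto
  also have "\<dots> = (Suc k * (n choose Suc k)) * (n choose i)"
    using assms step[of k] by (simp only: ac_simps)
  finally show ?thesis
    by (simp only: i_def mult.assoc Suc_eq_plus1)
qed

text \<open>Here \<open>w k\<close> is the number of sets with \<open>k\<close> rotations and \<open>d k\<close> is the number of MSTD sets minus the
  number of MDTS sets among them. The weights at \<open>k\<close> and \<open>m - k\<close> agree, so the sum of \<open>d\<close> over such a
  pair with \<open>k < M\<close> is at least \<open>- w k / 10\<close>, except for \<open>k = 0\<close>. By unimodality all
  these \<open>M\<close> pairs together lose at most \<open>M w M / 10 + w 0\<close>, and the \<open>m - 2 M + 1\<close> central terms gain at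
  least \<open>3 / 4 w M\<close> each. The choice of \<open>M\<close> amounts to \<open>M \<le> 4 (m - 2 M + 1)\<close>.\<close>

lemma weighted_sum_pos:
  fixes w d :: "nat \<Rightarrow> real"
  assumes m: "6 \<le> m" and M: "M = (4 * m + 4) div 9"
    and sym: "\<And>k. k \<le> m \<Longrightarrow> w (m - k) = w k"
    and incr: "\<And>k. 2 * k + 1 \<le> m \<Longrightarrow> w k \<le> w (k + 1)"
    and w0: "0 < w 0" "6 * w 0 \<le> w 1"
    and d0: "0 \<le> d 0" and d: "\<And>k. k \<le> m \<Longrightarrow> - w k \<le> d k"
    and low: "\<And>k. 1 \<le> k \<Longrightarrow> k < M \<Longrightarrow> 9 / 10 * w k \<le> d k"
    and mid: "\<And>k. M \<le> k \<Longrightarrow> k \<le> m - M \<Longrightarrow> 3 / 4 * w k \<le> d k"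
  shows "0 < (\<Sum>k\<le>m. d k)"
proof -
  have "9 * M \<le> 4 * m + 4"
    unfolding M by linarith
  moreover have M12: "1 \<le> M" "2 * M \<le> m"
    using m unfolding M by linarith+
  moreover obtain r where "m = 2 * M + r"
    using le_Suc_ex[OF M12(2)] by blast
  ultimately have M': "1 \<le> M" "2 * M \<le> m" "M \<le> 4 * (m - 2 * M + 1)"
    by simp_all
  have mono: "w a \<le> w b" if "a \<le> b" "2 * b \<le> m" for a b
    using that
  proof (induction b rule: dec_induct)
    case (step b)
    then show ?case
      using incr[of b] by force
  qed simp
  have split: "{..m} = {..<M} \<union> {M..m - M} \<union> (\<lambda>k. m - k) ` {..<M}"
  proof (intro equalityI subsetI)
    fix k assume "k \<in> {..m}"
    moreover have "k = m - (m - k)" if "k \<le> m"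
      using that by simp
    ultimately show "k \<in> {..<M} \<union> {M..m - M} \<union> (\<lambda>k. m - k) ` {..<M}"
      by (cases "k \<le> m - M") (auto intro!: image_eqI[of _ _ "m - k"])
  qed (use M' in auto)
  have inj: "inj_on (\<lambda>k. m - k) {..<M}"
    using M' by (auto simp: inj_on_def)
  have "(\<Sum>k\<le>m. d k) = (\<Sum>k<M. d k) + (\<Sum>k=M..m - M. d k) + (\<Sum>k\<in>(\<lambda>k. m - k) ` {..<M}. d k)"
    unfolding split using M'
    by (subst sum.union_disjoint, simp, simp, force, subst sum.union_disjoint) auto
  also have "(\<Sum>k\<in>(\<lambda>k. m - k) ` {..<M}. d k) = (\<Sum>k<M. d (m - k))"
    by (simp add: sum.reindex[OF inj])
  finally have eq: "(\<Sum>k\<le>m. d k) = (\<Sum>k<M. d k + d (m - k)) + (\<Sum>k=M..m - M. d k)"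
    by (simp add: sum.distrib)
  have "- (1 / 10 * w M) - (if k = 0 then w 0 else 0) \<le> d k + d (m - k)" if "k < M" for k
  proof -
    have *: "- w k \<le> d (m - k)" "w k \<le> w M" "0 < w M"
      using d[of "m - k"] sym[of k] mono[of k M] mono[of 0 M] w0 that M' by auto
    show ?thesis
      using * low[of k] d0 that by (cases "k = 0") auto
  qed
  then have "(\<Sum>k<M. - (1 / 10 * w M) - (if k = 0 then w 0 else 0)) \<le> (\<Sum>k<M. d k + d (m - k))"
    by (intro sum_mono) auto
  moreover have "(\<Sum>k<M. - (1 / 10 * w M) - (if k = 0 then w 0 else 0)) = - (real M * (1 / 10 * w M)) - w 0"
    using M' by (simp add: sum_subtractf sum_negf)
  ultimately have 1: "- (real M * (1 / 10 * w M)) - w 0 \<le> (\<Sum>k<M. d k + d (m - k))"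
    by simp
  have "3 / 4 * w M \<le> d k" if "k \<in> {M..m - M}" for k
  proof -
    have "w M \<le> w k"
    proof (cases "2 * k \<le> m")
      case True
      then show ?thesis
        using mono that by simp
    next
      case False
      then show ?thesis
        using mono[of M "m - k"] sym[of k] that M' by auto
    qed
    then show ?thesis
      using mid[of k] that by simp
  qed
  then have "(\<Sum>k=M..m - M. 3 / 4 * w M) \<le> (\<Sum>k=M..m - M. d k)"
    by (rule sum_mono)
  moreover have "card {M..m - M} = m - 2 * M + 1"
    using M' by simp
  ultimately have 2: "real (m - 2 * M + 1) * (3 / 4 * w M) \<le> (\<Sum>k=M..m - M. d k)"
    by simp
  have wM: "0 < w M" "6 * w 0 \<le> w M"
    using mono[of 1 M] w0 M' by auto
  have "real M * w M \<le> 4 * real (m - 2 * M + 1) * w M"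
    using M'(3) wM by (intro mult_right_mono) auto
  moreover have "w M \<le> real (m - 2 * M + 1) * w M"
    using wM by simp
  ultimately show ?thesis
    using 1 2 wM unfolding eq by linarith
qed

section \<open>Comparison of the two classes\<close>

text \<open>The surplus is bounded below twice: relative to \<open>m\<close> through \<open>\<sigma>\<close>, for the comparison with the
  mean, and absolutely by \<open>10\<close>, which absorbs the deduction of \<open>2\<close> from \<open>k (2 l - k + 1)\<close>.\<close>

lemma (in comm_group) card_not_MSTD_le:
  fixes k m :: nat and c \<delta> \<sigma> :: real
  assumes fin: "finite (carrier G)" and m: "6 \<le> m" and k: "k < m"
    and n: "real m ^ 2 * (111 + 5 * real (num_ord_le_2 G)) \<le> 2 * real (order G)"
    and s: "\<sigma> * real m \<le> 2 * real m - 3 * real k + 1" "10 \<le> real k * (2 * real m - 3 * real k + 1)"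
    and cube: "(2 * real k - real m) ^ 3 \<le> \<delta> * real m ^ 3"
    and c: "0 \<le> c" "0 \<le> \<sigma>" "c * (5 / 4 * (1 + \<delta>) + 5 / 12) \<le> 111 / 2 * \<sigma>" "c * (5 / 72) \<le> 5 / 2 * \<sigma>"
  defines "B \<equiv> {(R, F) \<in> size_pairs (carrier G) k (m - k). \<not> MSTD (gen_dihedral G) (dihedral_set R F)}"
  shows "c * real (card B) \<le> real (card (size_pairs (carrier G) k (m - k)))"
proof -
  define l where "l = m - k"
  define S where "S = real k * (2 * real l - real k + 1) - 2"
  define E where "E = 2 * (real k ^ 4 + 3 * real k ^ 2 * real l ^ 2 + real k * real l ^ 2
    + real k ^ 2 * real l + real (num_ord_le_2 G) * real k * real l)"
  let ?P = "size_pairs (carrier G) k l"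
  have l: "0 < l" "real k + real l = real m"
    using k by (auto simp: l_def)
  then have l': "2 * real l - real k + 1 = 2 * real m - 3 * real k + 1"
    "real k - real l = 2 * real k - real m"
    by linarith+
  have cE: "c * E \<le> real (order G) * S"
    unfolding E_def S_def
    by (rule margin_dominates_coincidences[where \<delta> = \<delta> and \<sigma> = \<sigma>])
      (use assms in \<open>simp_all add: l l'\<close>)
  have "S \<ge> 8"
    using s(2) unfolding S_def l' by simp
  moreover have "0 < order G"
    using fin order_gt_0_iff_finite by blast
  ultimately have pos: "0 < real (order G) * S"
    by simp
  have "real (order G) * S * (c * real (card B)) = c * (real (order G) * S * real (card B))"
    by simp
  also have "\<dots> \<le> c * (E * real (card ?P))"
    using card_not_MSTD_mult_margin_le[OF fin l(1), of k] c(1)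
    by (intro mult_left_mono) (simp_all add: B_def E_def S_def l_def)
  also have "\<dots> = (c * E) * real (card ?P)"
    by simp
  also have "\<dots> \<le> real (order G) * S * real (card ?P)"
    using cE by (intro mult_right_mono) auto
  finally show ?thesis
    using pos unfolding l_def by (simp only: mult_le_cancel_left_pos)
qed

theorem theorem1p8:
  fixes G :: "('a, 'b) monoid_scheme" and n m j :: nat
  assumes "comm_group G" and "finite (carrier G)" and "order G = n"
    and "j = num_ord_le_2 G"
    and "6 \<le> m" and "real m \<le> 1.3229 / sqrt (111 + 5 * real j) * sqrt (real n)"
  shows "card {A \<in> subsets_of_size (gen_dihedral G) m. MSTD (gen_dihedral G) A}
       > card {A \<in> subsets_of_size (gen_dihedral G) m. MDTS (gen_dihedral G) A}"
proof -
  interpret comm_group G by fact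
  let ?D = "gen_dihedral G" and ?P = "\<lambda>k. size_pairs (carrier G) k (m - k)"
  note fin = \<open>finite (carrier G)\<close>
  define M where "M = (4 * m + 4) div 9"
  define w where "w k = real (card (?P k))" for k
  define a where "a k = card {(R, F) \<in> ?P k. MSTD ?D (dihedral_set R F)}" for k
  define b where "b k = card {(R, F) \<in> ?P k. MDTS ?D (dihedral_set R F)}" for k
  define B where "B k = card {(R, F) \<in> ?P k. \<not> MSTD ?D (dihedral_set R F)}" for k
  \<comment> \<open>The estimates leave enough room to round \<open>1.3229\<^sup>2 < 1.7501\<close> up to \<open>2\<close>.\<close>
  have "real m ^ 2 \<le> (1.3229 / sqrt (111 + 5 * real j) * sqrt (real n)) ^ 2"
    using assms(6) by (rule power_mono) simp
  also have "\<dots> = 1.3229\<^sup>2 * real n / (111 + 5 * real j)"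
    by (simp add: power_mult_distrib power_divide)
  finally have "real m ^ 2 * (111 + 5 * real j) \<le> 1.3229\<^sup>2 * real n"
    by (simp add: field_simps)
  also have "\<dots> \<le> 2 * real n"
    by (intro mult_right_mono) (simp_all add: power2_eq_square)
  finally have n: "real m ^ 2 * (111 + 5 * real (num_ord_le_2 G)) \<le> 2 * real (order G)"
    using assms by simp
  have mn: "m \<le> n"
  proof -
    have "6 * 111 \<le> real m * (111 + 5 * real j)"
      using assms(5) by (intro mult_mono) auto
    then have "2 * real m \<le> real m * (real m * (111 + 5 * real j))"
      by (subst mult.commute, intro mult_left_mono) auto
    also have "\<dots> \<le> 2 * real n"
      using n \<open>order G = n\<close> \<open>j = num_ord_le_2 G\<close> by (simp add: power2_eq_square mult.assoc)
    finally show ?thesis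
      by simp
  qed
  have w: "w k = real ((n choose k) * (n choose (m - k)))" for k
    using assms by (simp add: w_def card_size_pairs fin order_def)
  have finP: "finite {(R, F) \<in> ?P k. Q R F}" for k Q
    by (rule finite_subset[OF _ finite_size_pairs[OF fin]]) auto
  have a: "real (a k) = w k - real (B k)" for k
  proof -
    have "?P k = {(R, F) \<in> ?P k. MSTD ?D (dihedral_set R F)} \<union> {(R, F) \<in> ?P k. \<not> MSTD ?D (dihedral_set R F)}"
      by auto
    moreover have "card ({(R, F) \<in> ?P k. MSTD ?D (dihedral_set R F)} \<union> {(R, F) \<in> ?P k. \<not> MSTD ?D (dihedral_set R F)})
        = a k + B k"
      unfolding a_def B_def by (intro card_Un_disjoint finP) auto
    ultimately show ?thesis
      by (simp add: w_def)
  qed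
  have b: "b k \<le> B k" for k
    unfolding b_def B_def by (intro card_mono finP) (auto simp: MSTD_def MDTS_def)
  \<comment> \<open>The second factor is at least \<open>(m - 1) / 3\<close>, hence at least \<open>2\<close> as an integer, which suffices from
    \<open>k = 5\<close> on. For \<open>k = 4\<close> the bound on \<open>k\<close> forces \<open>m \<ge> 7\<close>.\<close>
  have k10: "10 \<le> real k * (2 * real m - 3 * real k + 1)" if "1 \<le> k" "k \<le> m - M" for k
  proof -
    have k: "9 * int k \<le> 5 * int m + 4"
      using that assms(5) unfolding M_def by linarith
    then have s: "2 \<le> 2 * int m - 3 * int k + 1"
      using assms(5) by presburger
    have "10 \<le> int k * (2 * int m - 3 * int k + 1)"
    proof (cases "5 \<le> k")
      case True
      then show ?thesis
        using mult_mono[of 5 "int k" 2 "2 * int m - 3 * int k + 1"] s by simp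
    next
      case False
      then have "k = 1 \<or> k = 2 \<or> k = 3 \<or> k = 4"
        using that by linarith
      moreover have "7 \<le> m" if "k = 4"
        using k that by simp
      ultimately show ?thesis
        using assms(5) by auto
    qed
    then have "real_of_int 10 \<le> real_of_int (int k * (2 * int m - 3 * int k + 1))"
      by (simp only: of_int_le_iff)
    then show ?thesis
      by simp
  qed
  \<comment> \<open>Below \<open>M\<close> there are fewer rotations than reflections, so the cubic term is nonpositive.\<close>
  have low: "20 * real (B k) \<le> w k" if "1 \<le> k" "k < M" for k
    unfolding B_def w_def
  proof (rule card_not_MSTD_le[where \<delta> = 0 and \<sigma> = "2 / 3"])
    have "9 * k \<le> 4 * m - 5"
      using that assms(5) unfolding M_def by linarith
    then have k: "9 * real k \<le> 4 * real m - 5"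
      using assms(5) by linarith
    then show "2 / 3 * real m \<le> 2 * real m - 3 * real k + 1"
      by linarith
    have "0 \<le> (real m - 2 * real k) ^ 3"
      using k assms(5) by (intro zero_le_power) linarith
    moreover have "(2 * real k - real m) ^ 3 = - ((real m - 2 * real k) ^ 3)"
      by (simp add: power3_eq_cube algebra_simps)
    ultimately show "(2 * real k - real m) ^ 3 \<le> 0 * real m ^ 3"
      by simp
    have "k \<le> m - M"
      using that assms(5) unfolding M_def by linarith
    then show "10 \<le> real k * (2 * real m - 3 * real k + 1)"
      using k10 that by blast
    show "k < m"
      using that assms(5) unfolding M_def by linarith
  qed (use assms n in simp_all)
  \<comment> \<open>In the central range \<open>2 k - m \<le> (m + 8) / 9 \<le> 13 m / 50\<close>, and \<open>(13 / 50)\<^sup>3 < 1 / 50\<close>.\<close>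
  have mid: "8 * real (B k) \<le> w k" if "M \<le> k" "k \<le> m - M" for k
    unfolding B_def w_def
  proof (rule card_not_MSTD_le[where \<delta> = "1 / 50" and \<sigma> = "5 / 18"])
    have "9 * k \<le> 5 * m + 4"
      using that assms(5) unfolding M_def by linarith
    then have k: "9 * real k \<le> 5 * real m + 4"
      by linarith
    then show "5 / 18 * real m \<le> 2 * real m - 3 * real k + 1"
      using assms(5) by linarith
    show "(2 * real k - real m) ^ 3 \<le> 1 / 50 * real m ^ 3"
    proof (cases "m \<le> 2 * k")
      case True
      have "(2 * real k - real m) ^ 3 \<le> (13 / 50 * real m) ^ 3"
        using True k assms(5) by (intro power_mono) linarith+
      also have "\<dots> \<le> 1 / 50 * real m ^ 3"
        by (simp add: power_mult_distrib power_divide)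
      finally show ?thesis .
    next
      case False
      then have "0 \<le> (real m - 2 * real k) ^ 3"
        by (intro zero_le_power) linarith
      moreover have "(2 * real k - real m) ^ 3 = - ((real m - 2 * real k) ^ 3)"
        by (simp add: power3_eq_cube algebra_simps)
      moreover have "0 \<le> 1 / 50 * real m ^ 3"
        by simp
      ultimately show ?thesis
        by linarith
    qed
    have "1 \<le> k"
      using that assms(5) unfolding M_def by linarith
    then show "10 \<le> real k * (2 * real m - 3 * real k + 1)"
      using k10 that by blast
    show "k < m"
      using that assms(5) unfolding M_def by linarith
  qed (use assms n in simp_all)
  have "0 < (\<Sum>k\<le>m. real (a k) - real (b k))"
  proof (rule weighted_sum_pos[of m M w])
    show "w (m - k) = w k" if "k \<le> m" for k
      using that by (simp add: w mult.commute)
    show "w k \<le> w (k + 1)" if "2 * k + 1 \<le> m" for k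
    proof -
      have "(k + 1) * ((n choose k) * (n choose (m - k))) \<le> (m - k) * ((n choose k) * (n choose (m - k)))"
        using that by (intro mult_le_mono1) linarith
      also have "\<dots> \<le> (k + 1) * ((n choose (k + 1)) * (n choose (m - (k + 1))))"
        by (rule choose_mult_choose_step[OF mn that])
      finally show ?thesis
        unfolding w by (simp only: mult_le_cancel1 of_nat_le_iff)
    qed
    show "0 < w 0"
      using mn by (simp add: w)
    have "6 * ((n choose 0) * (n choose (m - 0))) \<le> (m - 0) * ((n choose 0) * (n choose (m - 0)))"
      using assms(5) by (intro mult_le_mono1) simp
    also have "\<dots> \<le> (0 + 1) * ((n choose (0 + 1)) * (n choose (m - (0 + 1))))"
      using assms(5) by (intro choose_mult_choose_step[OF mn]) simp
    finally have "real (6 * ((n choose 0) * (n choose (m - 0))))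
        \<le> real ((n choose 1) * (n choose (m - 1)))"
      by (simp only: of_nat_le_iff) simp
    then show "6 * w 0 \<le> w 1"
      unfolding w by simp
    have "{(R, F) \<in> ?P 0. MDTS ?D (dihedral_set R F)} = {}"
      using not_MDTS_if_no_rotations fin by (auto simp: size_pairs_def dest: finite_subset)
    then have "b 0 = 0"
      unfolding b_def by (simp only: card.empty)
    then show "0 \<le> real (a 0) - real (b 0)"
      by simp
    show "- w k \<le> real (a k) - real (b k)" for k
      using a[of k] b[of k] by linarith
    show "9 / 10 * w k \<le> real (a k) - real (b k)" if "1 \<le> k" "k < M" for k
      using low[OF that] a[of k] b[of k] by linarith
    show "3 / 4 * w k \<le> real (a k) - real (b k)" if "M \<le> k" "k \<le> m - M" for k
      using mid[OF that] a[of k] b[of k] by linarith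
  qed (use assms M_def in auto)
  then have "real (\<Sum>k\<le>m. b k) < real (\<Sum>k\<le>m. a k)"
    by (simp add: sum_subtractf)
  then show ?thesis
    unfolding card_subsets_of_size_gen_dihedral[OF fin] a_def b_def by (simp only: of_nat_less_iff)
qed

end
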